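(* Let $i\in\{1,\dots,N\}$, let $\mathcal{C}\subseteq\{1,\dots,N\}$ be a coalition with $i\in\mathcal{C}$, and let $\boldsymbol{\alpha}_i=[\alpha_{i1},\dots,\alpha_{iN}]$ be the corresponding combination weights, $\alpha_{ij}=\beta_j\,\mathbb{I}\{j\in\mathcal{C}\}/\sum_{k\in\mathcal{C}}\beta_k$. Let $\phi_{|\mathcal{H}|}$ be a quantity-aware function and $D$ a distribution difference for the hypothesis space $\mathcal{H}$ (both defined in the context). Let $\hat h_{\boldsymbol{\alpha}_i}\in\arg\min_{h\in\mathcal{H}}\sum_{j=1}^N\alpha_{ij}\hat\epsilon_j(h)$ be the weighted empirical risk minimizer and let $h_i^*\in\arg\min_{h\in\mathcal{H}}\epsilon_i(h)$ be client $i$'s expected risk minimizer. Then for any $\delta\in(0,\tfrac12)$, with probability at least $1-2\delta$ (over the choice of the samples), $$\epsilon_i(\hat h_{\boldsymbol{\alpha}_i})\;\le\;\epsilon_i(h_i^* )+2\,\phi_{|\mathcal{H}|}(\boldsymbol{\alpha}_i,\boldsymbol{\beta},m,\delta)+2\sum_{j\ne i}\alpha_{ij}\,D(\mathcal{D}_i,\mathcal{D}_j).$$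
   Context: There are $N$ clients. Client $j\in\{1,\dots,N\}$ has a dataset $\hat{\mathcal{D}}_j=\{(\boldsymbol{x}^{(j)}_k,\boldsymbol{y}^{(j)}_k)\}_{k=1}^{m_j}$ of $m_j\ge 1$ samples drawn from its underlying distribution $\mathcal{D}_j$ on $\mathcal{X}\times\mathcal{Y}$. Put $m=\sum_{j=1}^N m_j$ and $\boldsymbol{\beta}=[\beta_1,\dots,\beta_N]$ with $\beta_j=m_j/m$. $\mathcal{H}$ is a hypothesis space of models $h$ on $\mathcal{X}$ and $\ell$ is a real-valued risk function. The local expected risk is $\epsilon_j(h)=\mathbb{E}_{(\boldsymbol{x},\boldsymbol{y})\sim\mathcal{D}_j}\,\ell(h(\boldsymbol{x}),\boldsymbol{y})$ (assumed finite), and the local empirical risk is $\hat\epsilon_j(h)=\frac1{m_j}\sum_{k=1}^{m_j}\ell(h(\boldsymbol{x}^{(j)}_k),\boldsymbol{y}^{(j)}_k)$. For weights $\boldsymbol{\alpha}_i$ write $\epsilon_{\boldsymbol{\alpha}_i}(h)=\sum_{j=1}^N\alpha_{ij}\epsilon_j(h)$ and $\hat\epsilon_{\boldsymbol{\alpha}_i}(h)=\sum_{j=1}^N\alpha_{ij}\hat\epsilon_j(h)$. $\mathbb{I}$ is the indicator function. The minimizers appearing in the claim are assumed to exist. Quantity-aware function: $\phi_{|\mathcal{H}|}(\boldsymbol{\alpha}_i,\boldsymbol{\beta},m,\delta)$ is a real-valued function such that for any $\delta\in(0,1)$, with probability at least $1-\delta$ over the choice of the samples, $|\hat\epsilon_{\boldsymbol{\alpha}_i}(h)-\epsilon_{\boldsymbol{\alpha}_i}(h)|\le\phi_{|\mathcal{H}|}(\boldsymbol{\alpha}_i,\boldsymbol{\beta},m,\delta)$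 holds for all $h\in\mathcal{H}$. Distribution difference: $D$ is a real-valued function of pairs of distributions such that for any two client distributions $\mathcal{D}_i,\mathcal{D}_j$, $|\epsilon_i(h)-\epsilon_j(h)|\le D(\mathcal{D}_i,\mathcal{D}_j)$ holds for all $h\in\mathcal{H}$. *)

theory Defs
  imports "HOL-Probability.Probability"
begin

text \<open>
  Clients are numbered \<open>1, \<dots>, N\<close>; client \<open>j\<close> has \<open>m j\<close> samples. A joint draw of all datasets is
  a function \<open>S\<close> with \<open>S (j, k)\<close> the \<open>k\<close>-th sample (a pair of input and label) of client \<open>j\<close>.
  Vectors indexed by clients are functions on \<open>nat\<close>.
\<close>

text \<open>
  The event described by \<open>P\<close> need not be measurable (uniformity over an uncountable hypothesis
  space, an arbitrary choice of minimizers), so ``with probability at least \<open>p\<close>'' asks for a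
  measurable event of probability at least \<open>p\<close> on which \<open>P\<close> holds.
\<close>

definition with_prob_at_least :: "'a measure \<Rightarrow> real \<Rightarrow> ('a \<Rightarrow> bool) \<Rightarrow> bool" where
  "with_prob_at_least M p P \<longleftrightarrow> (\<exists>A\<in>sets M. p \<le> measure M A \<and> (\<forall>\<omega>\<in>A. P \<omega>))"

lemma (in finite_measure) with_prob_at_least_iff:
  assumes "{\<omega> \<in> space M. P \<omega>} \<in> sets M"
  shows "with_prob_at_least M p P \<longleftrightarrow> p \<le> measure M {\<omega> \<in> space M. P \<omega>}"
proof
  assume "with_prob_at_least M p P"
  then obtain A where A: "A \<in> sets M" "p \<le> measure M A" "\<forall>\<omega>\<in>A. P \<omega>"
    unfolding with_prob_at_least_def by blast
  have "A \<subseteq> {\<omega> \<in> space M. P \<omega>}"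
    using A sets.sets_into_space by blast
  with A assms show "p \<le> measure M {\<omega> \<in> space M. P \<omega>}"
    using finite_measure_mono order_trans by blast
next
  assume "p \<le> measure M {\<omega> \<in> space M. P \<omega>}"
  with assms show "with_prob_at_least M p P"
    unfolding with_prob_at_least_def by blast
qed

definition sample_measure ::
    "nat \<Rightarrow> (nat \<Rightarrow> nat) \<Rightarrow> (nat \<Rightarrow> ('x \<times> 'y) measure) \<Rightarrow> (nat \<times> nat \<Rightarrow> 'x \<times> 'y) measure" where
  "sample_measure N m \<D> = (\<Pi>\<^sub>M (j, k)\<in>(SIGMA j:{1..N}. {1..m j}). \<D> j)"

definition total_quantity :: "nat \<Rightarrow> (nat \<Rightarrow> nat) \<Rightarrow> nat" where
  "total_quantity N m = (\<Sum>j = 1..N. m j)"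

text \<open>The vector \<open>\<beta>\<close>, extended by zero outside \<open>{1..N}\<close> so that it depends only on the \<open>N\<close> clients.\<close>

definition quantity_distribution :: "nat \<Rightarrow> (nat \<Rightarrow> nat) \<Rightarrow> nat \<Rightarrow> real" where
  "quantity_distribution N m j =
     (if j \<in> {1..N} then real (m j) / real (total_quantity N m) else 0)"

definition coalition_weights :: "(nat \<Rightarrow> real) \<Rightarrow> nat set \<Rightarrow> nat \<Rightarrow> real" where
  "coalition_weights \<beta> C j = \<beta> j * indicator C j / (\<Sum>k\<in>C. \<beta> k)"

definition expected_risk ::
    "('z \<Rightarrow> 'y \<Rightarrow> real) \<Rightarrow> ('x \<times> 'y) measure \<Rightarrow> ('x \<Rightarrow> 'z) \<Rightarrow> real" where
  "expected_risk loss P h = (\<integral>(x, y). loss (h x) y \<partial>P)"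

definition empirical_risk ::
    "('z \<Rightarrow> 'y \<Rightarrow> real) \<Rightarrow> (nat \<Rightarrow> nat) \<Rightarrow> (nat \<times> nat \<Rightarrow> 'x \<times> 'y) \<Rightarrow> nat \<Rightarrow> ('x \<Rightarrow> 'z) \<Rightarrow> real" where
  "empirical_risk loss m S j h =
     1 / real (m j) * (\<Sum>k = 1..m j. case S (j, k) of (x, y) \<Rightarrow> loss (h x) y)"

definition weighted_expected_risk ::
    "nat \<Rightarrow> ('z \<Rightarrow> 'y \<Rightarrow> real) \<Rightarrow> (nat \<Rightarrow> ('x \<times> 'y) measure) \<Rightarrow> (nat \<Rightarrow> real) \<Rightarrow> ('x \<Rightarrow> 'z) \<Rightarrow> real" where
  "weighted_expected_risk N loss \<D> \<alpha> h = (\<Sum>j = 1..N. \<alpha> j * expected_risk loss (\<D> j) h)"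

definition weighted_empirical_risk ::
    "nat \<Rightarrow> ('z \<Rightarrow> 'y \<Rightarrow> real) \<Rightarrow> (nat \<Rightarrow> nat) \<Rightarrow> (nat \<times> nat \<Rightarrow> 'x \<times> 'y) \<Rightarrow> (nat \<Rightarrow> real) \<Rightarrow>
     ('x \<Rightarrow> 'z) \<Rightarrow> real" where
  "weighted_empirical_risk N loss m S \<alpha> h = (\<Sum>j = 1..N. \<alpha> j * empirical_risk loss m S j h)"

text \<open>
  A quantity-aware function takes \<open>\<alpha>\<close>, \<open>\<beta>\<close>, the total number of samples and \<open>\<delta>\<close>. Its defining
  property is stated for one given weight vector \<open>\<alpha>\<close>; its dependence on the size of the
  hypothesis space is implicit, as it is a quantity-aware function for the given \<open>H\<close>.
\<close>

definition quantity_aware ::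
    "nat \<Rightarrow> (nat \<Rightarrow> nat) \<Rightarrow> (nat \<Rightarrow> ('x \<times> 'y) measure) \<Rightarrow> ('x \<Rightarrow> 'z) set \<Rightarrow> ('z \<Rightarrow> 'y \<Rightarrow> real) \<Rightarrow>
     (nat \<Rightarrow> real) \<Rightarrow> ((nat \<Rightarrow> real) \<Rightarrow> (nat \<Rightarrow> real) \<Rightarrow> nat \<Rightarrow> real \<Rightarrow> real) \<Rightarrow> bool" where
  "quantity_aware N m \<D> H loss \<alpha> \<phi> \<longleftrightarrow>
     (\<forall>\<delta>. 0 < \<delta> \<and> \<delta> < 1 \<longrightarrow>
       with_prob_at_least (sample_measure N m \<D>) (1 - \<delta>)
         (\<lambda>S. \<forall>h\<in>H. \<bar>weighted_empirical_risk N loss m S \<alpha> h - weighted_expected_risk N loss \<D> \<alpha> h\<bar>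
                     \<le> \<phi> \<alpha> (quantity_distribution N m) (total_quantity N m) \<delta>))"

definition distribution_difference ::
    "nat \<Rightarrow> (nat \<Rightarrow> ('x \<times> 'y) measure) \<Rightarrow> ('x \<Rightarrow> 'z) set \<Rightarrow> ('z \<Rightarrow> 'y \<Rightarrow> real) \<Rightarrow>
     (('x \<times> 'y) measure \<Rightarrow> ('x \<times> 'y) measure \<Rightarrow> real) \<Rightarrow> bool" where
  "distribution_difference N \<D> H loss D \<longleftrightarrow>
     (\<forall>i\<in>{1..N}. \<forall>j\<in>{1..N}. \<forall>h\<in>H.
        \<bar>expected_risk loss (\<D> i) h - expected_risk loss (\<D> j) h\<bar> \<le> D (\<D> i) (\<D> j))"

end

theory Submission
  imports Defs
begin

text \<open>
  The weights are nonnegative and sum to one, so the weighted expected risk differs from client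
  \<open>i\<close>'s risk by at most \<open>B = \<Sum>\<^sub>j\<^sub>\<noteq>\<^sub>i \<alpha>\<^sub>j D(\<D>\<^sub>i, \<D>\<^sub>j)\<close>, and on the event of the quantity-aware function the
  weighted empirical risk differs from it by at most \<open>\<phi> + B\<close>, uniformly in the hypothesis.
  Minimizing an approximation costs at most twice the approximation error. A single event suffices,
  since the bound is uniform over \<open>H\<close>; so probability \<open>1 - \<delta>\<close> is in fact attained.
\<close>

text \<open>The measurable event that witnesses \<open>P\<close> also witnesses \<open>Q\<close>: it
  lies inside \<open>space M\<close>, so the implication applies at each of its points. Neither
  predicate has to define a measurable set.\<close>

lemma with_prob_at_least_mono:
  assumes "with_prob_at_least M p P" and "q \<le> p"
    and "\<And>\<omega>. \<omega> \<in> space M \<Longrightarrow> P \<omega> \<Longrightarrow> Q \<omega>"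
  shows "with_prob_at_least M q Q"
proof -
  obtain A where A: "A \<in> sets M" "p \<le> measure M A" "\<forall>\<omega>\<in>A. P \<omega>"
    using assms(1) unfolding with_prob_at_least_def by blast
  have "\<forall>\<omega>\<in>A. Q \<omega>"
    using A(1,3) assms(3) sets.sets_into_space by blast
  moreover have "q \<le> measure M A"
    using A(2) assms(2) by linarith
  ultimately show ?thesis
    using A(1) unfolding with_prob_at_least_def by blast
qed

lemma quantity_distribution_nonneg: "0 \<le> quantity_distribution N m j"
  by (simp add: quantity_distribution_def)

lemma quantity_distribution_pos:
  assumes "j \<in> {1..N}" and "0 < m j"
  shows "0 < quantity_distribution N m j"
proof -
  \<comment> \<open>This keeps the denominator of the quotient away from zero.\<close>
  have "m j \<le> total_quantity N m"
    unfolding total_quantity_def using assms(1) by (intro member_le_sum) auto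
  with assms show ?thesis
    by (simp add: quantity_distribution_def)
qed

lemma coalition_weights_nonneg:
  assumes "\<And>k. 0 \<le> \<beta> k"
  shows "0 \<le> coalition_weights \<beta> C j"
  unfolding coalition_weights_def by (intro divide_nonneg_nonneg mult_nonneg_nonneg sum_nonneg)
    (simp_all add: assms)

text \<open>The indicator cuts the sum of numerators down to \<open>C\<close>, where it equals the
  common denominator. If that denominator were 0, division by zero would make every weight
  0.\<close>

lemma sum_coalition_weights:
  assumes "finite A" and "C \<subseteq> A" and "(\<Sum>k\<in>C. \<beta> k) \<noteq> 0"
  shows "(\<Sum>j\<in>A. coalition_weights \<beta> C j) = 1"
proof -
  have "(\<Sum>j\<in>A. \<beta> j * indicator C j) = (\<Sum>j\<in>C. \<beta> j)"
    using assms(1,2) by (simp add: indicator_def if_distrib sum.If_cases Int_absorb1 cong: if_cong)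
  with assms(3) show ?thesis
    unfolding coalition_weights_def by (simp flip: sum_divide_distrib)
qed

text \<open>As the weights sum to one, \<open>e i\<close> is its own weighted average and can be
  moved under the sum. The triangle inequality then bounds the deviation term by term.\<close>

lemma abs_weighted_average_diff_le:
  fixes a e d :: "'a \<Rightarrow> real"
  assumes "finite A" and "i \<in> A" and "\<And>j. j \<in> A \<Longrightarrow> 0 \<le> a j" and "(\<Sum>j\<in>A. a j) = 1"
    and "\<And>j. j \<in> A \<Longrightarrow> \<bar>e i - e j\<bar> \<le> d j"
  shows "\<bar>(\<Sum>j\<in>A. a j * e j) - e i\<bar> \<le> (\<Sum>j\<in>A - {i}. a j * d j)"
proof -
  have "(\<Sum>j\<in>A. a j * e j) - e i = (\<Sum>j\<in>A. a j * (e j - e i))"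
    using assms(4) by (simp add: right_diff_distrib sum_subtractf flip: sum_distrib_right)
  \<comment> \<open>The term at \<open>i\<close> is zero, so \<open>d i\<close> does not enter the
    bound.\<close>
  also have "\<dots> = (\<Sum>j\<in>A - {i}. a j * (e j - e i))"
    using assms(1,2) by (simp add: sum.remove)
  also have "\<bar>\<dots>\<bar> \<le> (\<Sum>j\<in>A - {i}. \<bar>a j * (e j - e i)\<bar>)"
    by (rule sum_abs)
  also have "\<dots> \<le> (\<Sum>j\<in>A - {i}. a j * d j)"
  proof (rule sum_mono)
    fix j assume "j \<in> A - {i}"
    then show "\<bar>a j * (e j - e i)\<bar> \<le> a j * d j"
      using assms(3)[of j] assms(5)[of j]
      by (simp add: abs_mult abs_minus_commute mult_left_mono)
  qed
  finally show ?thesis .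
qed

text \<open>Pass from \<open>g\<close> to \<open>f\<close> at \<open>x\<close>, compare
  \<open>x\<close> with \<open>y\<close> under \<open>f\<close>, and return to \<open>g\<close> at
  \<open>y\<close>: \<open>g x \<le> f x + c \<le> f y + c \<le> g y + 2 * c\<close>. Each passage
  costs one \<open>c\<close>.\<close>

lemma is_arg_min_approx:
  fixes f g :: "'a \<Rightarrow> real"
  assumes "is_arg_min f P x" and "P y" and "\<And>z. P z \<Longrightarrow> \<bar>f z - g z\<bar> \<le> c"
  shows "g x \<le> g y + 2 * c"
proof -
  have "P x" and "f x \<le> f y"
    using assms(1,2) by (auto simp: is_arg_min_linorder)
  with assms(2) assms(3)[of x] assms(3)[of y] show ?thesis
    by linarith
qed

theorem theorem3p3:
  fixes N :: nat
    and m :: "nat \<Rightarrow> nat"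
    and X :: "'x set" and Y :: "'y set"
    and \<D> :: "nat \<Rightarrow> ('x \<times> 'y) measure"
    and H :: "('x \<Rightarrow> 'z) set"
    and loss :: "'z \<Rightarrow> 'y \<Rightarrow> real"
    and i :: nat and C :: "nat set"
    and \<alpha> \<beta> :: "nat \<Rightarrow> real"
    and \<phi> :: "(nat \<Rightarrow> real) \<Rightarrow> (nat \<Rightarrow> real) \<Rightarrow> nat \<Rightarrow> real \<Rightarrow> real"
    and D :: "('x \<times> 'y) measure \<Rightarrow> ('x \<times> 'y) measure \<Rightarrow> real"
    and h_hat :: "(nat \<times> nat \<Rightarrow> 'x \<times> 'y) \<Rightarrow> 'x \<Rightarrow> 'z"
    and h_star :: "'x \<Rightarrow> 'z"
    and \<delta> :: real
  defines "\<beta> \<equiv> quantity_distribution N m"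
    and "\<alpha> \<equiv> coalition_weights \<beta> C"
  assumes "\<And>j. j \<in> {1..N} \<Longrightarrow> m j \<ge> 1"
    and "\<And>j. j \<in> {1..N} \<Longrightarrow> prob_space (\<D> j)"
    and "\<And>j. j \<in> {1..N} \<Longrightarrow> space (\<D> j) = X \<times> Y"
    and "\<And>j h. j \<in> {1..N} \<Longrightarrow> h \<in> H \<Longrightarrow> integrable (\<D> j) (\<lambda>(x, y). loss (h x) y)"
    and "i \<in> {1..N}" and "C \<subseteq> {1..N}" and "i \<in> C"
    and "quantity_aware N m \<D> H loss \<alpha> \<phi>"
    and "distribution_difference N \<D> H loss D"
    and "\<And>S. S \<in> space (sample_measure N m \<D>) \<Longrightarrow>
           is_arg_min (weighted_empirical_risk N loss m S \<alpha>) (\<lambda>h. h \<in> H) (h_hat S)"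
    and "is_arg_min (expected_risk loss (\<D> i)) (\<lambda>h. h \<in> H) h_star"
    and "0 < \<delta>" and "\<delta> < 1 / 2"
  shows "with_prob_at_least (sample_measure N m \<D>) (1 - 2 * \<delta>)
           (\<lambda>S. expected_risk loss (\<D> i) (h_hat S)
                 \<le> expected_risk loss (\<D> i) h_star
                   + 2 * \<phi> \<alpha> \<beta> (total_quantity N m) \<delta>
                   + 2 * (\<Sum>j\<in>{1..N} - {i}. \<alpha> j * D (\<D> i) (\<D> j)))"
proof (rule with_prob_at_least_mono)
  let ?\<phi> = "\<phi> \<alpha> \<beta> (total_quantity N m) \<delta>"
  let ?B = "\<Sum>j\<in>{1..N} - {i}. \<alpha> j * D (\<D> i) (\<D> j)"
  show "with_prob_at_least (sample_measure N m \<D>) (1 - \<delta>)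
         (\<lambda>S. \<forall>h\<in>H. \<bar>weighted_empirical_risk N loss m S \<alpha> h - weighted_expected_risk N loss \<D> \<alpha> h\<bar>
                     \<le> ?\<phi>)"
    using assms(10,14,15) unfolding quantity_aware_def \<beta>_def by simp
  show "1 - 2 * \<delta> \<le> 1 - \<delta>"
    using \<open>0 < \<delta>\<close> by simp
  fix S
  assume S: "S \<in> space (sample_measure N m \<D>)"
    and event: "\<forall>h\<in>H. \<bar>weighted_empirical_risk N loss m S \<alpha> h
                        - weighted_expected_risk N loss \<D> \<alpha> h\<bar> \<le> ?\<phi>"
  have \<beta>_nonneg: "0 \<le> \<beta> j" for j
    by (simp add: \<beta>_def quantity_distribution_nonneg)
  have "0 < m i"
    using assms(3)[of i] \<open>i \<in> {1..N}\<close> by simp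
  then have "0 < \<beta> i"
    unfolding \<beta>_def using \<open>i \<in> {1..N}\<close> by (rule quantity_distribution_pos[rotated])
  \<comment> \<open>Client \<open>i\<close> belongs to the coalition and contributes a positive
    summand, so the normalization of \<open>\<alpha>\<close> is a genuine division.\<close>
  then have "0 < (\<Sum>k\<in>C. \<beta> k)"
    using \<open>i \<in> C\<close> finite_subset[OF \<open>C \<subseteq> {1..N}\<close>] by (intro sum_pos2) (auto simp: \<beta>_nonneg)
  then have sum_\<alpha>: "(\<Sum>j = 1..N. \<alpha> j) = 1"
    unfolding \<alpha>_def using \<open>C \<subseteq> {1..N}\<close> by (intro sum_coalition_weights) auto
  have \<alpha>_nonneg: "0 \<le> \<alpha> j" for j
    by (simp add: \<alpha>_def coalition_weights_nonneg \<beta>_nonneg)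
  have bias: "\<bar>weighted_expected_risk N loss \<D> \<alpha> h - expected_risk loss (\<D> i) h\<bar> \<le> ?B"
    if "h \<in> H" for h
    unfolding weighted_expected_risk_def
    using \<open>i \<in> {1..N}\<close> assms(11) that sum_\<alpha> \<alpha>_nonneg
    by (intro abs_weighted_average_diff_le) (auto simp: distribution_difference_def)
  have approx: "\<bar>weighted_empirical_risk N loss m S \<alpha> h - expected_risk loss (\<D> i) h\<bar> \<le> ?\<phi> + ?B"
    if "h \<in> H" for h
    using bspec[OF event that] bias[OF that] by linarith
  have "h_star \<in> H"
    using assms(13) by (simp add: is_arg_min_def)
  \<comment> \<open>Here \<open>f\<close> is the weighted empirical risk, minimized by
    \<open>h_hat S\<close>, and \<open>g\<close> is the expected risk of client \<open>i\<close>;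
    \<open>h_star\<close> is the competitor.\<close>
  have "expected_risk loss (\<D> i) (h_hat S) \<le> expected_risk loss (\<D> i) h_star + 2 * (?\<phi> + ?B)"
    using assms(12)[OF S] \<open>h_star \<in> H\<close> approx
    by (rule is_arg_min_approx[where P = "\<lambda>h. h \<in> H"])
  then show "expected_risk loss (\<D> i) (h_hat S) \<le> expected_risk loss (\<D> i) h_star + 2 * ?\<phi> + 2 * ?B"
    by (simp add: algebra_simps)
qed

end
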